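(* Let $n\ge 1$, let $f_1,\dots,f_n:\mathsf H\to\mathbb R$ be functions on a separable real Hilbert space $\mathsf H$, let $F=\frac1n\sum_{i=1}^n f_i$, and assume $\operatorname{argmin}F\neq\varnothing$. Assume that each $f_i$ is convex and $L$-smooth for some $L>0$. Let $(\boldsymbol x^k)_{k\in\mathbb N}$ be generated by the generic algorithm described in the context with constant step size $\alpha>0$, and suppose that the variance assumptions (B.i), (B.ii), (B.iii) described in the context hold with constants $A,B,C\ge 0$, $\rho\in[0,1]$ and a non-positive random variable $D$, where moreover $\rho>0$. Let $M>0$ and $\alpha>0$ be such that $M\ge B/\rho$ and $\alpha<1/(A+MC)$. Then, for all integers $k\ge 1$, $$\mathsf E\big[F(\bar{\boldsymbol x}^k)-F_*\big]\le \frac{\operatorname{dist}(\boldsymbol x^0,\operatorname{argmin}F)^2+\alpha^2M\,\mathsf E[\sigma_0^2]}{2\alpha k\,[1-\alpha(A+MC)]},\qquad \bar{\boldsymbol x}^k=\frac1k\sum_{t=0}^{k-1}\boldsymbol x^t .$$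
   Context: Notation: $F_*=\inf F$; $\operatorname{dist}(x,S)=\inf_{z\in S}\|x-z\|$; $\operatorname{prox}_{\varphi}(x)=\operatorname{argmin}_{y\in\mathsf H}\{\varphi(y)+\frac12\|y-x\|^2\}$. A function $f$ is $L$-smooth if it is differentiable and $\|\nabla f(x)-\nabla f(y)\|\le L\|x-y\|$ for all $x,y\in\mathsf H$. All random variables live on a probability space $(\Omega,\mathfrak A,\mathsf P)$. Generic algorithm: $(\boldsymbol e^k)_{k\in\mathbb N}$ is a sequence of random vectors in $\mathsf H$, $(i_k)_{k\in\mathbb N}$ is a sequence of i.i.d. random variables uniformly distributed on $\{1,\dots,n\}$ such that $i_k$ is independent of $\boldsymbol e^0,\dots,\boldsymbol e^{k-1}$, $\alpha>0$, the initial point $\boldsymbol x^0\in\mathsf H$ is deterministic, and for $k=0,1,\dots$ $$\boldsymbol x^{k+1}=\operatorname{prox}_{\alpha f_{i_k}}\big(\boldsymbol x^k+\alpha\boldsymbol e^k\big).$$ Variance assumptions: put $\boldsymbol v^k=\nabla f_{i_k}(\boldsymbol x^k)-\boldsymbol e^k$. There exist $A,B,C\in[0,+\infty)$, $\rho\in[0,1]$, a non-positive real-valued random variable $D$, real-valued random variables $\sigma_k$ ($k\in\mathbb N$), and $\sigma$-algebras $\mathfrak F_k\subset\mathfrak F_{k+1}\subset\mathfrak A$ such that $i_{k-1}$ (for $k\ge1$) and $\boldsymbol x^k$ are $\mathfrak F_k$-measurable, $i_k$ is independent of $\mathfrak F_k$, and for every $k\in\mathbb N$: (B.i) $\mathsf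 E[\boldsymbol e^k\mid\mathfrak F_k]=0$ a.s.; (B.ii) $\mathsf E[\|\boldsymbol v^k\|^2\mid\mathfrak F_k]\le 2A(F(\boldsymbol x^k)-F_* )+B\sigma_k^2+D$ a.s.; (B.iii) $\mathsf E[\sigma_{k+1}^2]\le(1-\rho)\mathsf E[\sigma_k^2]+2C\,\mathsf E[F(\boldsymbol x^k)-F_*]$. *)

theory Defs
  imports "HOL-Probability.Probability"
begin

definition argmin :: "('h \<Rightarrow> real) \<Rightarrow> 'h set" where
  "argmin \<phi> = {x. \<forall>y. \<phi> x \<le> \<phi> y}"

definition prox :: "('h::real_inner \<Rightarrow> real) \<Rightarrow> 'h \<Rightarrow> 'h" where
  "prox \<phi> x = arg_min (\<lambda>y. \<phi> y + 1 / 2 * (norm (y - x))\<^sup>2) (\<lambda>_. True)"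

definition gradient :: "('h::real_inner \<Rightarrow> real) \<Rightarrow> 'h \<Rightarrow> 'h" where
  "gradient \<phi> x = (THE D. GDERIV \<phi> x :> D)"

definition smooth_with :: "real \<Rightarrow> ('h::real_inner \<Rightarrow> real) \<Rightarrow> bool" where
  "smooth_with L \<phi> \<longleftrightarrow> (\<forall>x. \<phi> differentiable (at x)) \<and>
     (\<forall>x y. norm (gradient \<phi> x - gradient \<phi> y) \<le> L * norm (x - y))"

definition average :: "nat \<Rightarrow> (nat \<Rightarrow> 'h \<Rightarrow> real) \<Rightarrow> 'h \<Rightarrow> real" where
  "average n f x = 1 / real n * (\<Sum>i = 1..n. f i x)"

definition Inf_val :: "('h \<Rightarrow> real) \<Rightarrow> real" where
  "Inf_val \<phi> = (INF z. \<phi> z)"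

text \<open>HOL-Probability only has conditional expectations of real and of extended nonnegative
  functions. For vector-valued \<open>X\<close>, \<open>has_cond_exp P G X Y\<close> says that \<open>Y\<close> is a version of
  \<open>E[X | G]\<close>.\<close>

definition has_cond_exp ::
  "'w measure \<Rightarrow> 'w measure \<Rightarrow> ('w \<Rightarrow> 'h) \<Rightarrow> ('w \<Rightarrow> 'h::{banach, second_countable_topology}) \<Rightarrow> bool" where
  "has_cond_exp P G X Y \<longleftrightarrow>
     integrable P X \<and> integrable P Y \<and> Y \<in> borel_measurable G \<and>
     (\<forall>S\<in>sets G. (LINT \<omega>:S|P. X \<omega>) = (LINT \<omega>:S|P. Y \<omega>))"

text \<open>Independence of the random index \<open>i k\<close> from a sub-\<open>\<sigma>\<close>-algebra or from a random vector is
  independence of the generated \<open>\<sigma>\<close>-algebras; the library's \<open>indep_var\<close> would require both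
  variables to have the same value type. For \<open>e 0, \<dots>, e (k - 1)\<close> the independence is the joint one.\<close>

definition generic_algorithm ::
  "'w measure \<Rightarrow> nat \<Rightarrow> (nat \<Rightarrow> 'h \<Rightarrow> real) \<Rightarrow> real \<Rightarrow> 'h \<Rightarrow> (nat \<Rightarrow> 'w \<Rightarrow> nat) \<Rightarrow>
   (nat \<Rightarrow> 'w \<Rightarrow> 'h) \<Rightarrow> (nat \<Rightarrow> 'w \<Rightarrow> 'h::{real_inner, banach, second_countable_topology}) \<Rightarrow> bool" where
  "generic_algorithm P n f \<alpha> x0 i e x \<longleftrightarrow>
     (\<forall>k. e k \<in> borel_measurable P) \<and>
     prob_space.indep_vars P (\<lambda>_. count_space {1..n}) i UNIV \<and>
     (\<forall>k. distr P (count_space {1..n}) (i k) = uniform_count_measure {1..n}) \<and>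
     (\<forall>k. prob_space.indep_set P
        (sets (vimage_algebra (space P) (i k) (count_space {1..n})))
        (sets (vimage_algebra (space P) (\<lambda>\<omega>. \<lambda>j\<in>{..<k}. e j \<omega>) (PiM {..<k} (\<lambda>_. borel))))) \<and>
     (\<forall>\<omega>\<in>space P. x 0 \<omega> = x0) \<and>
     (\<forall>k. \<forall>\<omega>\<in>space P.
        x (Suc k) \<omega> = prox (\<lambda>y. \<alpha> * f (i k \<omega>) y) (x k \<omega> + \<alpha> *\<^sub>R e k \<omega>))"

definition v_err ::
  "(nat \<Rightarrow> 'h \<Rightarrow> real) \<Rightarrow> (nat \<Rightarrow> 'w \<Rightarrow> nat) \<Rightarrow> (nat \<Rightarrow> 'w \<Rightarrow> 'h) \<Rightarrow>
   (nat \<Rightarrow> 'w \<Rightarrow> 'h::real_inner) \<Rightarrow> nat \<Rightarrow> 'w \<Rightarrow> 'h" where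
  "v_err f i e x k \<omega> = gradient (f (i k \<omega>)) (x k \<omega>) - e k \<omega>"

text \<open>The (conditional) expectations of nonnegative variables are taken in \<open>[0, \<infinity>]\<close>, so that no
  integrability is presupposed. The bound on the conditional second moment of \<open>v_err\<close> is compared in
  \<open>ereal\<close>, because its right-hand side may a priori be negative and \<open>ennreal\<close> would truncate it
  to \<open>0\<close>.\<close>

definition variance_assumptions ::
  "'w measure \<Rightarrow> nat \<Rightarrow> (nat \<Rightarrow> 'h \<Rightarrow> real) \<Rightarrow> (nat \<Rightarrow> 'w \<Rightarrow> nat) \<Rightarrow> (nat \<Rightarrow> 'w \<Rightarrow> 'h) \<Rightarrow>
   (nat \<Rightarrow> 'w \<Rightarrow> 'h::{real_inner, banach, second_countable_topology}) \<Rightarrow>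
   real \<Rightarrow> real \<Rightarrow> real \<Rightarrow> real \<Rightarrow> ('w \<Rightarrow> real) \<Rightarrow> (nat \<Rightarrow> 'w \<Rightarrow> real) \<Rightarrow> (nat \<Rightarrow> 'w measure) \<Rightarrow> bool" where
  "variance_assumptions P n f i e x A B C \<rho> D \<sigma> \<FF> \<longleftrightarrow>
     0 \<le> A \<and> 0 \<le> B \<and> 0 \<le> C \<and> 0 \<le> \<rho> \<and> \<rho> \<le> 1 \<and>
     D \<in> borel_measurable P \<and> (\<forall>\<omega>\<in>space P. D \<omega> \<le> 0) \<and>
     (\<forall>k. \<sigma> k \<in> borel_measurable P) \<and>
     (\<forall>k. subalgebra P (\<FF> k) \<and> subalgebra (\<FF> (Suc k)) (\<FF> k)) \<and>
     (\<forall>k. i k \<in> measurable (\<FF> (Suc k)) (count_space {1..n})) \<and>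
     (\<forall>k. x k \<in> borel_measurable (\<FF> k)) \<and>
     (\<forall>k. prob_space.indep_set P
        (sets (vimage_algebra (space P) (i k) (count_space {1..n}))) (sets (\<FF> k))) \<and>
     (\<forall>k. has_cond_exp P (\<FF> k) (e k) (\<lambda>_. 0)) \<and>
     (\<forall>k. AE \<omega> in P.
        enn2ereal (nn_cond_exp P (\<FF> k) (\<lambda>\<omega>'. ennreal ((norm (v_err f i e x k \<omega>'))\<^sup>2)) \<omega>)
        \<le> ereal (2 * A * (average n f (x k \<omega>) - Inf_val (average n f)) + B * (\<sigma> k \<omega>)\<^sup>2 + D \<omega>)) \<and>
     (\<forall>k. (\<integral>\<^sup>+\<omega>. ennreal ((\<sigma> (Suc k) \<omega>)\<^sup>2) \<partial>P)
        \<le> ennreal (1 - \<rho>) * (\<integral>\<^sup>+\<omega>. ennreal ((\<sigma> k \<omega>)\<^sup>2) \<partial>P)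
          + ennreal (2 * C) * (\<integral>\<^sup>+\<omega>. ennreal (average n f (x k \<omega>) - Inf_val (average n f)) \<partial>P))"

end

(* For w in argmin F, the three-point inequality of the proximal map, the tangent inequality of
   f_{i_k} at x^k and a Young-type inequality give, pointwise,
     |x^{k+1} - w|^2 <= |x^k - w|^2 + alpha^2 |v^k|^2 + 2 alpha <e^k, x^k - w>
                        - 2 alpha (f_{i_k}(x^k) - f_{i_k}(w)).
   In expectation the inner product vanishes by (B.i), the sampled gap becomes E[F(x^k) - F_*] because
   i_k is uniform and independent of x^k, and (B.ii) bounds the variance term.  By (B.iii) and
   B <= rho M, the Lyapunov function E|x^k - w|^2 + alpha^2 M E[sigma_k^2] then decreases by at least
   2 alpha (1 - alpha (A + M C)) E[F(x^k) - F_*].  Telescoping, Jensen's inequality and letting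
   |x^0 - w| tend to the distance of x^0 to argmin F give the bound.  If E[sigma_0^2] is infinite, so
   is the right-hand side; otherwise all the second moments involved are finite by induction. *)

theory Submission
  imports Defs
begin

subsection \<open>Gradients and proximal maps in Hilbert spaces\<close>

text \<open>Restricted to the line through \<open>a\<close> and \<open>b\<close>, this is the
  one-variable tangent inequality at 0, evaluated at 1. It is phrased with an arbitrary derivative
  because the existence of gradients is derived from it later, by way of \<open>exists_prox\<close>
  and \<open>Riesz_representation\<close>.\<close>

lemma convex_above_tangent:
  fixes g :: "'h::real_normed_vector \<Rightarrow> real"
  assumes "convex_on UNIV g" and deriv: "(g has_derivative g') (at a)"
  shows "g b \<ge> g a + g' (b - a)"
proof -
  define h where "h t = g (a + t *\<^sub>R (b - a))" for t :: real
  have "convex_on UNIV h"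
  proof (rule convex_onI)
    fix t r s :: real
    assume t: "0 < t" "t < 1"
    have "a + ((1 - t) *\<^sub>R r + t *\<^sub>R s) *\<^sub>R (b - a)
        = (1 - t) *\<^sub>R (a + r *\<^sub>R (b - a)) + t *\<^sub>R (a + s *\<^sub>R (b - a))"
      by (simp add: algebra_simps)
    then show "h ((1 - t) *\<^sub>R r + t *\<^sub>R s) \<le> (1 - t) * h r + t * h s"
      unfolding h_def using convex_onD[OF assms(1)] t by simp
  qed auto
  interpret g': bounded_linear g'
    using deriv by (rule has_derivative_bounded_linear)
  have "(g has_derivative g') (at (a + 0 *\<^sub>R (b - a)))"
    using deriv by simp
  moreover have "((\<lambda>t. a + t *\<^sub>R (b - a)) has_derivative (\<lambda>t. t *\<^sub>R (b - a))) (at 0)"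
    by (auto intro!: derivative_eq_intros)
  ultimately have "(h has_derivative (\<lambda>t. g' (t *\<^sub>R (b - a)))) (at 0)"
    unfolding h_def using has_derivative_compose by blast
  then have "(h has_field_derivative g' (b - a)) (at 0)"
    by (simp add: has_field_derivative_def g'.scaleR mult_commute_abs)
  with \<open>convex_on UNIV h\<close> have "h 1 - h 0 \<ge> g' (b - a) * (1 - 0)"
    by (intro convex_on_imp_above_tangent[where A = UNIV]) auto
  then show ?thesis
    by (simp add: h_def)
qed

text \<open>Parallelogram law for \<open>a - z\<close> and \<open>b - z\<close>. The negative last
  term expresses the strong convexity of the squared norm.\<close>

lemma midpoint_norm_square:
  fixes a b z :: "'h::real_inner"
  shows "(norm ((1/2) *\<^sub>R (a + b) - z))\<^sup>2
      = (norm (a - z))\<^sup>2 / 2 + (norm (b - z))\<^sup>2 / 2 - (norm (a - b))\<^sup>2 / 4"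
  unfolding power2_norm_eq_inner
  by (simp add: inner_simps inner_commute field_simps)

text \<open>The quadratic term makes the objective strongly convex, so every minimizing sequence is
  Cauchy; its limit is a minimizer by completeness and continuity. No compactness enters.\<close>

lemma exists_prox:
  fixes g :: "'h::{real_inner, banach} \<Rightarrow> real"
  assumes "convex_on UNIV g" and diff: "\<And>y. g differentiable (at y)"
  shows "\<exists>y. \<forall>w. g y + 1 / 2 * (norm (y - z))\<^sup>2 \<le> g w + 1 / 2 * (norm (w - z))\<^sup>2"
proof -
  define \<phi> where "\<phi> y = g y + 1 / 2 * (norm (y - z))\<^sup>2" for y
  have "continuous_on UNIV g"
    using diff by (meson continuous_at_imp_continuous_on differentiable_imp_continuous_within)
  then have cont: "continuous_on UNIV \<phi>"
    unfolding \<phi>_def by (intro continuous_intros)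
  obtain g' where g': "(g has_derivative g') (at z)"
    using diff by (auto simp: differentiable_def)
  interpret g': bounded_linear g'
    using g' by (rule has_derivative_bounded_linear)
  obtain K where K: "\<And>h. norm (g' h) \<le> norm h * K"
    using g'.bounded by blast
  \<comment> \<open>The tangent of \<open>g\<close> at \<open>z\<close> falls at most linearly, with
    slope \<open>K\<close>, and the quadratic term compensates for it: complete the square in
    \<open>norm (y - z) - K\<close>.\<close>
  have "\<phi> y \<ge> g z - 1 / 2 * K\<^sup>2" for y
  proof -
    have "g y \<ge> g z + g' (y - z)"
      using assms(1) g' by (rule convex_above_tangent)
    moreover have "g' (y - z) \<ge> - (norm (y - z) * K)"
      using K[of "y - z"] by simp
    moreover have "1 / 2 * (norm (y - z))\<^sup>2 - norm (y - z) * K + 1 / 2 * K\<^sup>2 \<ge> 0"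
      using zero_le_power2[of "norm (y - z) - K"] by (simp add: power2_diff)
    ultimately show ?thesis
      unfolding \<phi>_def by linarith
  qed
  then have bdd: "bdd_below (range \<phi>)"
    by (auto intro!: bdd_belowI)
  define m where "m = (INF y. \<phi> y)"
  have m_le: "m \<le> \<phi> y" for y
    unfolding m_def using bdd by (auto intro: cINF_lower)
  have "\<exists>y. \<phi> y < m + 1 / real (Suc j)" for j
    using cINF_less_iff[of UNIV \<phi> "m + 1 / real (Suc j)"] bdd by (auto simp: m_def)
  then obtain s where s: "\<And>j. \<phi> (s j) < m + 1 / real (Suc j)"
    by metis
  \<comment> \<open>The infimum \<open>m\<close> also bounds the value at the midpoint from below,
    so the gain in the midpoint inequality is at most the mean excess of the two values over
    \<open>m\<close>.\<close>
  have strong: "(norm (a - b))\<^sup>2 \<le> 4 * ((\<phi> a - m) + (\<phi> b - m))" for a b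
  proof -
    have "g ((1/2) *\<^sub>R (a + b)) \<le> g a / 2 + g b / 2"
      using convex_onD[OF assms(1), of "1/2" a b] by (simp add: scaleR_add_right)
    then have "\<phi> ((1/2) *\<^sub>R (a + b)) \<le> \<phi> a / 2 + \<phi> b / 2 - (norm (a - b))\<^sup>2 / 8"
      unfolding \<phi>_def midpoint_norm_square by (simp add: field_simps)
    with m_le[of "(1/2) *\<^sub>R (a + b)"] show ?thesis
      by (simp add: field_simps)
  qed
  have lim0: "(\<lambda>j. 1 / real (Suc j)) \<longlonglongrightarrow> 0"
    using LIMSEQ_inverse_real_of_nat by (simp add: inverse_eq_divide)
  have "Cauchy s"
  proof (rule CauchyI)
    fix \<epsilon> :: real
    assume "0 < \<epsilon>"
    \<comment> \<open>Two excesses below \<open>\<epsilon>\<^sup>2 / 8\<close>, multiplied by the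
      factor 4 of \<open>strong\<close>, give exactly \<open>\<epsilon>\<^sup>2\<close>.\<close>
    then have "0 < \<epsilon>\<^sup>2 / 8"
      by simp
    then obtain N where N: "1 / real (Suc N) < \<epsilon>\<^sup>2 / 8"
      by (metis inverse_eq_divide reals_Archimedean)
    have small: "\<phi> (s j) - m < \<epsilon>\<^sup>2 / 8" if "j \<ge> N" for j
    proof -
      have "1 / real (Suc j) \<le> 1 / real (Suc N)"
        using that by (intro divide_left_mono) auto
      with s[of j] N show ?thesis
        by linarith
    qed
    have "norm (s p - s q) < \<epsilon>" if "p \<ge> N" "q \<ge> N" for p q
    proof -
      have "(norm (s p - s q))\<^sup>2 < \<epsilon>\<^sup>2"
        using strong[of "s p" "s q"] small[OF that(1)] small[OF that(2)] by simp
      then show ?thesis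
        using \<open>0 < \<epsilon>\<close> by (simp add: power_less_imp_less_base)
    qed
    then show "\<exists>N. \<forall>p\<ge>N. \<forall>q\<ge>N. norm (s p - s q) < \<epsilon>"
      by blast
  qed
  then obtain y where y: "s \<longlonglongrightarrow> y"
    using Cauchy_convergent_iff convergent_def by blast
  have "(\<lambda>j. \<phi> (s j)) \<longlonglongrightarrow> \<phi> y"
    using cont y by (simp add: continuous_on_tendsto_compose)
  moreover have "(\<lambda>j. m + 1 / real (Suc j)) \<longlonglongrightarrow> m + 0"
    using lim0 by (intro tendsto_intros)
  ultimately have "\<phi> y \<le> m + 0"
    using s by (intro LIMSEQ_le) (auto intro: less_imp_le)
  then show ?thesis
    using m_le unfolding \<phi>_def by (auto intro: order_trans)
qed

lemma has_derivative_half_norm_square: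
  fixes z :: "'h::real_inner"
  shows "((\<lambda>y. 1 / 2 * (norm (y - z))\<^sup>2) has_derivative (\<lambda>h. inner (y - z) h)) (at y)"
  unfolding power2_norm_eq_inner
  by (auto intro!: derivative_eq_intros simp: inner_commute)

text \<open>Fermat's rule for the proximal objective. A derivative \<open>g'\<close> stands in place
  of the gradient because the Riesz representation is itself obtained from this lemma.\<close>

lemma prox_stationary:
  fixes g :: "'h::real_inner \<Rightarrow> real"
  assumes "(g has_derivative g') (at y)"
    and "\<And>w. g y + 1 / 2 * (norm (y - z))\<^sup>2 \<le> g w + 1 / 2 * (norm (w - z))\<^sup>2"
  shows "g' h = inner (z - y) h"
proof -
  have "((\<lambda>y. g y + 1 / 2 * (norm (y - z))\<^sup>2) has_derivative (\<lambda>h. g' h + inner (y - z) h)) (at y)"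
    using assms(1) has_derivative_half_norm_square by (rule has_derivative_add)
  then have "(\<lambda>h. g' h + inner (y - z) h) = (\<lambda>h. 0)"
    by (rule has_derivative_local_min) (use assms(2) in auto)
  then show ?thesis
    by (metis add_diff_cancel_right' diff_0 inner_minus_left minus_diff_eq)
qed

text \<open>The representing vector of a functional \<open>\<phi>\<close> is the minimizer of \<open>\<parallel>y\<parallel>\<^sup>2 / 2 - \<phi> y\<close>.\<close>

lemma Riesz_representation:
  fixes \<phi> :: "'h::{real_inner, banach} \<Rightarrow> real"
  assumes "bounded_linear \<phi>"
  obtains d where "\<And>h. \<phi> h = inner h d"
proof -
  interpret bounded_linear \<phi>
    by fact
  have deriv: "((\<lambda>y. - \<phi> y) has_derivative (\<lambda>h. - \<phi> h)) (at y)" for y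
    using assms by (intro has_derivative_minus bounded_linear_imp_has_derivative)
  have "convex_on UNIV (\<lambda>y. - \<phi> y)"
    by (intro convex_onI) (auto simp: add diff scaleR algebra_simps)
  then obtain d where "\<forall>w. - \<phi> d + 1 / 2 * (norm (d - 0))\<^sup>2 \<le> - \<phi> w + 1 / 2 * (norm (w - 0))\<^sup>2"
    using exists_prox[of "\<lambda>y. - \<phi> y" 0] deriv by (auto simp: differentiable_def)
  with prox_stationary[OF deriv, of d 0] have "- \<phi> h = inner (0 - d) h" for h
    by blast
  then have "\<phi> h = inner h d" for h
    by (metis diff_0 inner_commute inner_minus_left neg_equal_iff_equal)
  then show ?thesis
    by (rule that)
qed

text \<open>Since \<open>gradient\<close> is a definite description, the Riesz representation
  supplies existence and uniqueness of derivatives shows that it denotes the representing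
  vector.\<close>

lemma has_derivative_gradient:
  fixes g :: "'h::{real_inner, banach} \<Rightarrow> real"
  assumes "g differentiable (at y)"
  shows "(g has_derivative (\<lambda>h. inner (gradient g y) h)) (at y)"
proof -
  obtain g' where g': "(g has_derivative g') (at y)"
    using assms by (auto simp: differentiable_def)
  obtain d where d: "\<And>h. g' h = inner h d"
    using Riesz_representation[OF has_derivative_bounded_linear[OF g']] by blast
  then have gd: "GDERIV g y :> d"
    unfolding gderiv_def using g' by (metis (no_types, lifting) ext)
  have "d' = d" if "GDERIV g y :> d'" for d'
  proof -
    have "(\<lambda>h. inner h d') = (\<lambda>h. inner h d)"
      using that gd unfolding gderiv_def by (rule has_derivative_unique)
    then show ?thesis
      by (metis vector_eq_ldot)
  qed
  then have "gradient g y = d"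
    unfolding gradient_def using gd by blast
  then show ?thesis
    using gd by (simp add: gderiv_def inner_commute)
qed

lemma convex_above_gradient:
  fixes g :: "'h::{real_inner, banach} \<Rightarrow> real"
  assumes "convex_on UNIV g" "g differentiable (at a)"
  shows "g b \<ge> g a + inner (gradient g a) (b - a)"
  using convex_above_tangent[OF assms(1) has_derivative_gradient[OF assms(2)]] .

text \<open>The choice operator behind \<open>prox\<close> returns a genuine minimizer as soon as
  one exists, which is \<open>exists_prox\<close>.\<close>

lemma prox_minimizes:
  fixes g :: "'h::{real_inner, banach} \<Rightarrow> real"
  assumes "convex_on UNIV g" "\<And>y. g differentiable (at y)"
  shows "g (prox g z) + 1 / 2 * (norm (prox g z - z))\<^sup>2 \<le> g w + 1 / 2 * (norm (w - z))\<^sup>2"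
proof -
  obtain y where "is_arg_min (\<lambda>y. g y + 1 / 2 * (norm (y - z))\<^sup>2) (\<lambda>_. True) y"
    using exists_prox[OF assms, of z] by (auto simp: is_arg_min_linorder)
  then have "is_arg_min (\<lambda>y. g y + 1 / 2 * (norm (y - z))\<^sup>2) (\<lambda>_. True) (prox g z)"
    unfolding prox_def arg_min_def by (rule someI)
  then show ?thesis
    by (simp add: is_arg_min_linorder)
qed

text \<open>By stationarity the gradient of \<open>g\<close> at \<open>y\<close> is
  \<open>z - y\<close>; insert it into the tangent inequality at \<open>y\<close> and expand the
  squared norm of \<open>y - w\<close>. The term in \<open>y - z\<close> is kept, for it later
  absorbs a cross term.\<close>

lemma prox_three_point:
  fixes g :: "'h::{real_inner, banach} \<Rightarrow> real" and z :: 'h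
  assumes "convex_on UNIV g" and diff: "\<And>y. g differentiable (at y)"
  defines "y \<equiv> prox g z"
  shows "(norm (y - w))\<^sup>2 \<le> (norm (z - w))\<^sup>2 - (norm (y - z))\<^sup>2 - 2 * (g y - g w)"
proof -
  have "inner (gradient g y) h = inner (z - y) h" for h
    using prox_stationary[OF has_derivative_gradient[OF diff]] prox_minimizes[OF assms(1,2)]
    unfolding y_def by blast
  with convex_above_gradient[OF assms(1) diff, of y w]
  have "g w \<ge> g y + inner (z - y) (w - y)"
    by simp
  moreover have "(norm (y - w))\<^sup>2 = (norm (z - w))\<^sup>2 - (norm (y - z))\<^sup>2 + 2 * inner (z - y) (w - y)"
    unfolding power2_norm_eq_inner by (simp add: inner_simps inner_commute)
  ultimately show ?thesis
    by argo
qed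

text \<open>The three-point inequality controls the value of \<open>g\<close> at the new point
  \<open>y\<close>; the tangent at \<open>a\<close> replaces it by the value at the old point. This
  costs a multiple of the inner product of \<open>gradient g a - e\<close> with
  \<open>y - a\<close>, which Young's inequality trades for the squared norm of
  \<open>gradient g a - e\<close>.\<close>

lemma prox_step_descent:
  fixes g :: "'h::{real_inner, banach} \<Rightarrow> real" and a e :: 'h
  assumes "convex_on UNIV g" and diff: "\<And>y. g differentiable (at y)" and "\<alpha> > 0"
  defines "y \<equiv> prox (\<lambda>u. \<alpha> * g u) (a + \<alpha> *\<^sub>R e)"
  shows "(norm (y - w))\<^sup>2 \<le> (norm (a - w))\<^sup>2 + \<alpha>\<^sup>2 * (norm (gradient g a - e))\<^sup>2
      + 2 * \<alpha> * inner e (a - w) - 2 * \<alpha> * (g a - g w)"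
proof -
  have "convex_on UNIV (\<lambda>u. \<alpha> * g u)"
    using assms by (intro convex_on_cmul) auto
  moreover have "(\<lambda>u. \<alpha> * g u) differentiable (at u)" for u
    using diff by (intro differentiable_mult) auto
  ultimately have "(norm (y - w))\<^sup>2 \<le> (norm (a + \<alpha> *\<^sub>R e - w))\<^sup>2 - (norm (y - (a + \<alpha> *\<^sub>R e)))\<^sup>2
      - 2 * (\<alpha> * g y - \<alpha> * g w)"
    unfolding y_def by (rule prox_three_point)
  \<comment> \<open>The two squared norms of \<open>\<alpha> *\<^sub>R e\<close> cancel, so no
    second moment of \<open>e\<close> alone appears in the bound.\<close>
  also have "(norm (a + \<alpha> *\<^sub>R e - w))\<^sup>2 - (norm (y - (a + \<alpha> *\<^sub>R e)))\<^sup>2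
      = (norm (a - w))\<^sup>2 + 2 * \<alpha> * inner e (a - w) - (norm (y - a))\<^sup>2 + 2 * \<alpha> * inner e (y - a)"
    unfolding power2_norm_eq_inner by (simp add: inner_simps inner_commute algebra_simps)
  finally have 1: "(norm (y - w))\<^sup>2 \<le> (norm (a - w))\<^sup>2 + 2 * \<alpha> * inner e (a - w)
      - (norm (y - a))\<^sup>2 + 2 * \<alpha> * inner e (y - a) - 2 * (\<alpha> * g y - \<alpha> * g w)" .
  have "g y \<ge> g a + inner (gradient g a) (y - a)"
    by (rule convex_above_gradient[OF assms(1) diff])
  then have 2: "\<alpha> * g y \<ge> \<alpha> * (g a + inner (gradient g a) (y - a))"
    using \<open>\<alpha> > 0\<close> by simp
  \<comment> \<open>Young's inequality in the form of a square, weighted so that it uses up exactly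
    the available negative term in \<open>y - a\<close>.\<close>
  have "0 \<le> (norm ((y - a) + \<alpha> *\<^sub>R (gradient g a - e)))\<^sup>2"
    by simp
  also have "\<dots> = (norm (y - a))\<^sup>2 + \<alpha>\<^sup>2 * (norm (gradient g a - e))\<^sup>2
      + 2 * \<alpha> * inner (gradient g a) (y - a) - 2 * \<alpha> * inner e (y - a)"
    unfolding power2_norm_eq_inner
    by (simp add: inner_simps inner_commute algebra_simps power2_eq_square)
  finally show ?thesis
    using 1 2 by (simp add: algebra_simps)
qed

text \<open>The tangents at \<open>a\<close> and at \<open>w\<close> bound the difference from both
  sides. The growth is at most quadratic in \<open>norm (a - w)\<close>, so a finite second moment
  of the iterates makes function gaps integrable.\<close>

lemma smooth_convex_gap_bound:
  fixes g :: "'h::{real_inner, banach} \<Rightarrow> real"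
  assumes "convex_on UNIV g" "smooth_with L g"
  shows "\<bar>g a - g w\<bar> \<le> (norm (gradient g w) + L * norm (a - w)) * norm (a - w)"
proof -
  have diff: "g differentiable (at y)" for y
    using assms(2) by (simp add: smooth_with_def)
  have grad: "norm (gradient g a - gradient g w) \<le> L * norm (a - w)"
    using assms(2) by (simp add: smooth_with_def)
  \<comment> \<open>Read off from the Lipschitz bound, whose left-hand side is a norm.\<close>
  then have pos: "0 \<le> L * norm (a - w)"
    using norm_ge_zero order_trans by blast
  have "g a - g w \<le> inner (gradient g a) (a - w)"
    using convex_above_gradient[OF assms(1) diff, of a w] by (simp add: inner_diff_right)
  also have "\<dots> \<le> norm (gradient g a) * norm (a - w)"
    by (rule norm_cauchy_schwarz)
  also have "\<dots> \<le> (norm (gradient g w) + L * norm (a - w)) * norm (a - w)"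
    using grad norm_triangle_sub[of "gradient g a" "gradient g w"]
    by (intro mult_right_mono) auto
  finally have 1: "g a - g w \<le> \<dots>" .
  have "g w - g a \<le> - inner (gradient g w) (a - w)"
    using convex_above_gradient[OF assms(1) diff, of w a] by simp
  also have "\<dots> \<le> norm (gradient g w) * norm (a - w)"
    using Cauchy_Schwarz_ineq2[of "gradient g w" "a - w"] by linarith
  also have "\<dots> \<le> (norm (gradient g w) + L * norm (a - w)) * norm (a - w)"
    using pos by (intro mult_right_mono) auto
  finally show ?thesis
    using 1 by linarith
qed

subsection \<open>Expectations\<close>

text \<open>By definition the conditional expectation is tested only on sets of \<open>G\<close>.
  Linearity extends this to simple functions, and dominated convergence to \<open>Y\<close>; the
  integrable product of norms provides the majorant.\<close>

lemma (in prob_space) has_cond_exp_zero_orthogonal: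
  fixes X Y :: "'a \<Rightarrow> 'h::{real_inner, banach, second_countable_topology}"
  assumes sub: "subalgebra M G" and ce: "has_cond_exp M G X (\<lambda>_. 0)"
    and Y: "Y \<in> borel_measurable G"
    and int: "integrable M (\<lambda>\<omega>. norm (X \<omega>) * norm (Y \<omega>))"
  shows "(LINT \<omega>|M. inner (X \<omega>) (Y \<omega>)) = 0"
proof -
  have X: "integrable M X"
    and zero: "\<And>S. S \<in> sets G \<Longrightarrow> (LINT \<omega>:S|M. X \<omega>) = 0"
    using ce by (auto simp: has_cond_exp_def set_lebesgue_integral_def)
  have [measurable]: "X \<in> borel_measurable M" "Y \<in> borel_measurable M"
    using X Y sub by (auto intro: measurable_from_subalg)
  have space: "space G = space M" and sets: "sets G \<subseteq> sets M"
    using sub by (auto simp: subalgebra_def)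
  \<comment> \<open>The approximants are simple with respect to \<open>G\<close>, so that their
    level sets are admissible test sets. Base point 0 turns the distance bound into a bound by the
    norm of \<open>Y\<close>.\<close>
  obtain s where s: "\<And>j. simple_function G (s j)"
    "\<And>\<omega>. \<omega> \<in> space M \<Longrightarrow> (\<lambda>j. s j \<omega>) \<longlonglongrightarrow> Y \<omega>"
    "\<And>j \<omega>. \<omega> \<in> space M \<Longrightarrow> norm (s j \<omega>) \<le> 2 * norm (Y \<omega>)"
    using borel_measurable_implies_sequence_metric[OF Y, of 0] by (simp add: space) metis
  have [measurable]: "s j \<in> borel_measurable M" for j
    using borel_measurable_simple_function[OF s(1)] sub by (rule measurable_from_subalg[rotated])
  have "(LINT \<omega>|M. inner (X \<omega>) (s j \<omega>)) = 0" for j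
  proof -
    define T where "T y = s j -` {y} \<inter> space M" for y
    have T: "T y \<in> sets G" for y
      using simple_functionD(2)[OF s(1), of j "{y}"] by (simp add: T_def space)
    have fin: "finite (s j ` space M)"
      using simple_functionD(1)[OF s(1), of j] by (simp add: space)
    have int_T: "integrable M (\<lambda>\<omega>. indicator (T y) \<omega> *\<^sub>R X \<omega>)" for y
      using X T sets by (intro integrable_mult_indicator) auto
    have "(LINT \<omega>|M. inner (X \<omega>) (s j \<omega>))
        = (LINT \<omega>|M. (\<Sum>y\<in>s j ` space M. inner (indicator (T y) \<omega> *\<^sub>R X \<omega>) y))"
    proof (rule Bochner_Integration.integral_cong)
      fix \<omega> assume "\<omega> \<in> space M"
      then have "(\<Sum>y\<in>s j ` space M. inner (indicator (T y) \<omega> *\<^sub>R X \<omega>) y)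
          = (\<Sum>y\<in>s j ` space M. if y = s j \<omega> then inner (X \<omega>) y else 0)"
        by (intro sum.cong) (auto simp: T_def)
      with fin \<open>\<omega> \<in> space M\<close>
      show "inner (X \<omega>) (s j \<omega>) = (\<Sum>y\<in>s j ` space M. inner (indicator (T y) \<omega> *\<^sub>R X \<omega>) y)"
        by simp
    qed simp
    \<comment> \<open>On each level set the second argument is a constant vector and leaves the
      integral; what remains is the integral of \<open>X\<close> over a set of
      \<open>G\<close>.\<close>
    also have "\<dots> = (\<Sum>y\<in>s j ` space M. inner (LINT \<omega>|M. indicator (T y) \<omega> *\<^sub>R X \<omega>) y)"
      using int_T
      by (subst Bochner_Integration.integral_sum) (auto intro!: sum.cong simp del: inner_scaleR_left)
    also have "\<dots> = 0"
      using zero[OF T] by (simp add: set_lebesgue_integral_def)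
    finally show ?thesis .
  qed
  moreover have "(\<lambda>j. LINT \<omega>|M. inner (X \<omega>) (s j \<omega>)) \<longlonglongrightarrow> (LINT \<omega>|M. inner (X \<omega>) (Y \<omega>))"
  proof (rule integral_dominated_convergence)
    show "integrable M (\<lambda>\<omega>. 2 * (norm (X \<omega>) * norm (Y \<omega>)))"
      using int by simp
    show "AE \<omega> in M. (\<lambda>j. inner (X \<omega>) (s j \<omega>)) \<longlonglongrightarrow> inner (X \<omega>) (Y \<omega>)"
      using s(2) by (auto intro!: tendsto_intros)
    show "AE \<omega> in M. norm (inner (X \<omega>) (s j \<omega>)) \<le> 2 * (norm (X \<omega>) * norm (Y \<omega>))" for j
    proof (intro AE_I2)
      fix \<omega> assume "\<omega> \<in> space M"
      then have "norm (X \<omega>) * norm (s j \<omega>) \<le> norm (X \<omega>) * (2 * norm (Y \<omega>))"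
        using s(3) by (intro mult_left_mono) auto
      then show "norm (inner (X \<omega>) (s j \<omega>)) \<le> 2 * (norm (X \<omega>) * norm (Y \<omega>))"
        using Cauchy_Schwarz_ineq2[of "X \<omega>" "s j \<omega>"] by simp
    qed
  qed measurable
  ultimately show ?thesis
    by (simp add: LIMSEQ_const_iff)
qed

text \<open>Split according to the value of \<kappa>: \<open>h (\<kappa> \<omega>) \<omega>\<close>
  is the sum over \<open>j\<close> of \<open>h j\<close> times the indicator of \<kappa> being
  \<open>j\<close>. Each indicator has mean \<open>1 / real n\<close> and is independent of the
  \<open>G\<close>-measurable factor, so the expectation of the product factorizes.\<close>

lemma (in prob_space) indep_uniform_index_integral:
  fixes \<kappa> :: "'a \<Rightarrow> nat" and h :: "nat \<Rightarrow> 'a \<Rightarrow> real"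
  assumes "n \<ge> 1" and \<kappa>: "\<kappa> \<in> measurable M (count_space {1..n})"
    and unif: "distr M (count_space {1..n}) \<kappa> = uniform_count_measure {1..n}"
    and indep: "indep_set (sets (vimage_algebra (space M) \<kappa> (count_space {1..n}))) (sets G)"
    and sub: "subalgebra M G"
    and h: "\<And>j. j \<in> {1..n} \<Longrightarrow> h j \<in> borel_measurable G"
    and int: "\<And>j. j \<in> {1..n} \<Longrightarrow> integrable M (h j)"
  shows "integrable M (\<lambda>\<omega>. h (\<kappa> \<omega>) \<omega>)"
    and "(LINT \<omega>|M. h (\<kappa> \<omega>) \<omega>) = (LINT \<omega>|M. 1 / real n * (\<Sum>j=1..n. h j \<omega>))"
proof -
  define I where "I j \<omega> = (indicator (\<kappa> -` {j} \<inter> space M) \<omega> :: real)" for j \<omega>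
  have space: "space G = space M"
    using sub by (simp add: subalgebra_def)
  have \<kappa>_set: "\<kappa> -` {j} \<inter> space M \<in> sets (vimage_algebra (space M) \<kappa> (count_space {1..n}))"
    if "j \<in> {1..n}" for j
    using that by (intro in_vimage_algebra) auto
  have ev: "\<kappa> -` {j} \<inter> space M \<in> sets M" if "j \<in> {1..n}" for j
    using \<kappa>_set[OF that] indep_setD_ev1[OF indep] by blast
  have I_int: "integrable M (I j)" "(LINT \<omega>|M. I j \<omega>) = 1 / real n" if j: "j \<in> {1..n}" for j
  proof -
    have "emeasure M (\<kappa> -` {j} \<inter> space M) = emeasure (uniform_count_measure {1..n}) {j}"
      using j \<kappa> by (subst unif[symmetric], subst emeasure_distr) auto
    also have "\<dots> = ennreal (1 / real n)"
      using j by (subst emeasure_uniform_count_measure) auto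
    finally have "measure M (\<kappa> -` {j} \<inter> space M) = 1 / real n"
      by (simp add: measure_def)
    with ev[OF j] show "integrable M (I j)" "(LINT \<omega>|M. I j \<omega>) = 1 / real n"
      unfolding I_def by (simp_all add: emeasure_eq_measure)
  qed
  \<comment> \<open>Independence passes to smaller \<sigma>-algebras: the indicator generates a part
    of that of \<kappa>, and \<open>h j\<close> a part of \<open>G\<close>.\<close>
  have ind: "indep_var borel (I j) borel (h j)" if j: "j \<in> {1..n}" for j
  proof -
    have "sigma_sets (space M) {I j -` A \<inter> space M |A. A \<in> sets borel}
        \<subseteq> sets (vimage_algebra (space M) \<kappa> (count_space {1..n}))"
    proof -
      have "I j \<in> borel_measurable (vimage_algebra (space M) \<kappa> (count_space {1..n}))"
        unfolding I_def using \<kappa>_set[OF j] by simp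
      then show ?thesis
        using sets.top[of "vimage_algebra (space M) \<kappa> (count_space {1..n})"]
        by (intro sets.sigma_sets_subset') (auto dest: measurable_sets)
    qed
    moreover have "sigma_sets (space M) {h j -` A \<inter> space M |A. A \<in> sets borel} \<subseteq> sets G"
      using h[OF j] sets.top[of G]
      by (intro sets.sigma_sets_subset') (auto simp: space dest: measurable_sets)
    moreover have "I j \<in> borel_measurable M" "h j \<in> borel_measurable M"
      using I_int(1)[OF j] int[OF j] by auto
    ultimately show ?thesis
      unfolding indep_var_eq indep_sets2_eq
      using indep unfolding indep_sets2_eq by blast
  qed
  have eq: "h (\<kappa> \<omega>) \<omega> = (\<Sum>j=1..n. I j \<omega> * h j \<omega>)" if "\<omega> \<in> space M" for \<omega>
  proof -
    have "\<kappa> \<omega> \<in> {1..n}"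
      using measurable_space[OF \<kappa> that] by simp
    moreover have "(\<Sum>j=1..n. I j \<omega> * h j \<omega>) = (\<Sum>j=1..n. if j = \<kappa> \<omega> then h j \<omega> else 0)"
      using that by (intro sum.cong) (auto simp: I_def)
    ultimately show ?thesis
      by simp
  qed
  have prod_int: "integrable M (\<lambda>\<omega>. I j \<omega> * h j \<omega>)" if "j \<in> {1..n}" for j
    using indep_var_integrable[OF ind] I_int int that by blast
  then have "integrable M (\<lambda>\<omega>. \<Sum>j=1..n. I j \<omega> * h j \<omega>)"
    by (intro Bochner_Integration.integrable_sum) auto
  then show "integrable M (\<lambda>\<omega>. h (\<kappa> \<omega>) \<omega>)"
    by (subst Bochner_Integration.integrable_cong[OF refl eq])
  have "(LINT \<omega>|M. h (\<kappa> \<omega>) \<omega>) = (LINT \<omega>|M. (\<Sum>j=1..n. I j \<omega> * h j \<omega>))"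
    by (rule Bochner_Integration.integral_cong[OF refl eq])
  also have "\<dots> = (\<Sum>j=1..n. LINT \<omega>|M. I j \<omega> * h j \<omega>)"
    using prod_int by (intro Bochner_Integration.integral_sum) auto
  also have "\<dots> = (\<Sum>j=1..n. 1 / real n * (LINT \<omega>|M. h j \<omega>))"
    using indep_var_lebesgue_integral[OF ind] I_int int by (intro sum.cong) auto
  also have "\<dots> = (LINT \<omega>|M. 1 / real n * (\<Sum>j=1..n. h j \<omega>))"
    using int by (simp add: Bochner_Integration.integral_sum sum_distrib_left)
  finally show "(LINT \<omega>|M. h (\<kappa> \<omega>) \<omega>) = (LINT \<omega>|M. 1 / real n * (\<Sum>j=1..n. h j \<omega>))" .
qed

section \<open>Square-integrable random vectors\<close>

lemma (in prob_space) integrable_norm_square_add: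
  fixes X Y :: "'a \<Rightarrow> 'h::{real_inner, banach, second_countable_topology}"
  assumes [measurable]: "X \<in> borel_measurable M" "Y \<in> borel_measurable M"
    and "integrable M (\<lambda>\<omega>. (norm (X \<omega>))\<^sup>2)" "integrable M (\<lambda>\<omega>. (norm (Y \<omega>))\<^sup>2)"
  shows "integrable M (\<lambda>\<omega>. (norm (X \<omega> + Y \<omega>))\<^sup>2)"
proof (rule Bochner_Integration.integrable_bound)
  show "integrable M (\<lambda>\<omega>. 2 * (norm (X \<omega>))\<^sup>2 + 2 * (norm (Y \<omega>))\<^sup>2)"
    using assms by auto
  show "AE \<omega> in M. norm ((norm (X \<omega> + Y \<omega>))\<^sup>2) \<le> norm (2 * (norm (X \<omega>))\<^sup>2 + 2 * (norm (Y \<omega>))\<^sup>2)"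
  proof (intro AE_I2)
    fix \<omega>
    have "(norm (X \<omega> + Y \<omega>))\<^sup>2 + (norm (X \<omega> - Y \<omega>))\<^sup>2 = 2 * (norm (X \<omega>))\<^sup>2 + 2 * (norm (Y \<omega>))\<^sup>2"
      unfolding power2_norm_eq_inner by (simp add: inner_simps inner_commute)
    then show "norm ((norm (X \<omega> + Y \<omega>))\<^sup>2) \<le> norm (2 * (norm (X \<omega>))\<^sup>2 + 2 * (norm (Y \<omega>))\<^sup>2)"
      unfolding real_norm_def
      using zero_le_power2[of "norm (X \<omega> - Y \<omega>)"] zero_le_power2[of "norm (X \<omega> + Y \<omega>)"] by linarith
  qed
qed measurable

lemma (in prob_space) integrable_norm_mult:
  fixes X Y :: "'a \<Rightarrow> 'h::{real_inner, banach, second_countable_topology}"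
  assumes [measurable]: "X \<in> borel_measurable M" "Y \<in> borel_measurable M"
    and "integrable M (\<lambda>\<omega>. (norm (X \<omega>))\<^sup>2)" "integrable M (\<lambda>\<omega>. (norm (Y \<omega>))\<^sup>2)"
  shows "integrable M (\<lambda>\<omega>. norm (X \<omega>) * norm (Y \<omega>))"
proof (rule Bochner_Integration.integrable_bound)
  show "integrable M (\<lambda>\<omega>. (norm (X \<omega>))\<^sup>2 + (norm (Y \<omega>))\<^sup>2)"
    using assms by auto
  show "AE \<omega> in M. norm (norm (X \<omega>) * norm (Y \<omega>)) \<le> norm ((norm (X \<omega>))\<^sup>2 + (norm (Y \<omega>))\<^sup>2)"
  proof (intro AE_I2)
    fix \<omega>
    have "2 * (norm (X \<omega>) * norm (Y \<omega>)) \<le> (norm (X \<omega>))\<^sup>2 + (norm (Y \<omega>))\<^sup>2"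
      using sum_squares_bound[of "norm (X \<omega>)" "norm (Y \<omega>)"] by simp
    moreover have "0 \<le> norm (X \<omega>) * norm (Y \<omega>)"
      by simp
    ultimately show "norm (norm (X \<omega>) * norm (Y \<omega>)) \<le> norm ((norm (X \<omega>))\<^sup>2 + (norm (Y \<omega>))\<^sup>2)"
      unfolding real_norm_def by linarith
  qed
qed measurable

subsection \<open>The Lyapunov argument\<close>

text \<open>Lets a bound proved for each point of \<open>S\<close> pass to the infimal distance by a
  limit, without a nearest point.\<close>

lemma infdist_approx:
  fixes a :: "'h::metric_space"
  assumes "S \<noteq> {}"
  obtains s where "\<And>j::nat. s j \<in> S" "(\<lambda>j. dist a (s j)) \<longlonglongrightarrow> infdist a S"
proof -
  have "\<exists>w\<in>S. dist a w < infdist a S + inverse (real (Suc j))" for j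
    using assms cINF_less_iff[of S "dist a" "infdist a S + inverse (real (Suc j))"]
    by (auto simp: infdist_notempty)
  then obtain s where s: "\<And>j. s j \<in> S" "\<And>j. dist a (s j) < infdist a S + inverse (real (Suc j))"
    by metis
  moreover have "(\<lambda>j. dist a (s j)) \<longlonglongrightarrow> infdist a S"
  proof (rule tendsto_sandwich[where f = "\<lambda>_. infdist a S"])
    show "(\<lambda>j. infdist a S + inverse (real (Suc j))) \<longlonglongrightarrow> infdist a S"
      using tendsto_add[OF tendsto_const LIMSEQ_inverse_real_of_nat, of "infdist a S"] by simp
  qed (use s in \<open>auto intro!: always_eventually infdist_le intro: less_imp_le simp del: of_nat_Suc\<close>)
  ultimately show ?thesis
    using that by blast
qed

lemma Inf_val_argmin: "w \<in> argmin \<phi> \<Longrightarrow> Inf_val \<phi> = \<phi> w"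
  unfolding Inf_val_def argmin_def by (auto intro!: cInf_eq_minimum)

section \<open>The random iteration: measurability and pathwise descent\<close>

locale variance_reduced_prox = prob_space P
  for P :: "'w measure" +
  fixes f :: "nat \<Rightarrow> 'h::{real_inner, banach, second_countable_topology} \<Rightarrow> real"
    and x e :: "nat \<Rightarrow> 'w \<Rightarrow> 'h" and x0 :: 'h
    and i :: "nat \<Rightarrow> 'w \<Rightarrow> nat" and \<sigma> :: "nat \<Rightarrow> 'w \<Rightarrow> real" and D :: "'w \<Rightarrow> real"
    and \<FF> :: "nat \<Rightarrow> 'w measure"
    and L \<alpha> A B C \<rho> :: real and n :: nat
  assumes n_pos: "n \<ge> 1"
    and convex: "\<And>j. j \<in> {1..n} \<Longrightarrow> convex_on UNIV (f j)"
    and smooth: "\<And>j. j \<in> {1..n} \<Longrightarrow> smooth_with L (f j)"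
    and \<alpha>_pos: "\<alpha> > 0"
    and algorithm: "generic_algorithm P n f \<alpha> x0 i e x"
    and variance: "variance_assumptions P n f i e x A B C \<rho> D \<sigma> \<FF>"
begin

definition gap :: "nat \<Rightarrow> 'w \<Rightarrow> real" where
  "gap k \<omega> = average n f (x k \<omega>) - Inf_val (average n f)"

lemma index_measurable [measurable]: "i k \<in> measurable P (count_space {1..n})"
  using algorithm by (auto simp: generic_algorithm_def indep_vars_def)

lemma index_in: "\<omega> \<in> space P \<Longrightarrow> i k \<omega> \<in> {1..n}"
  using measurable_space[OF index_measurable] by simp

lemma subalg: "subalgebra P (\<FF> k)"
  using variance by (simp add: variance_assumptions_def)

lemma iterate_measurable_filtration: "x k \<in> borel_measurable (\<FF> k)"
  using variance by (simp add: variance_assumptions_def)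

lemma iterate_measurable [measurable]: "x k \<in> borel_measurable P"
  using subalg iterate_measurable_filtration by (rule measurable_from_subalg)

lemma error_measurable [measurable]: "e k \<in> borel_measurable P"
  using algorithm by (simp add: generic_algorithm_def)

lemma \<sigma>_measurable [measurable]: "\<sigma> k \<in> borel_measurable P"
  using variance by (simp add: variance_assumptions_def)

lemma differentiable: "j \<in> {1..n} \<Longrightarrow> f j differentiable (at y)"
  using smooth by (simp add: smooth_with_def)

lemma component_measurable: "j \<in> {1..n} \<Longrightarrow> f j \<in> borel_measurable borel"
  using differentiable
  by (intro borel_measurable_continuous_onI)
     (meson continuous_at_imp_continuous_on differentiable_imp_continuous_within)

lemma gradient_measurable:
  assumes "j \<in> {1..n}"
  shows "gradient (f j) \<in> borel_measurable borel"
proof -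
  \<comment> \<open>A Lipschitz constant in the sense of \<open>lipschitz_on\<close> is nonnegative,
    hence the maximum.\<close>
  have "(max L 0)-lipschitz_on UNIV (gradient (f j))"
  proof (rule lipschitz_onI)
    fix y z
    have "norm (gradient (f j) y - gradient (f j) z) \<le> L * norm (y - z)"
      using smooth[OF assms] by (simp add: smooth_with_def)
    also have "\<dots> \<le> max L 0 * norm (y - z)"
      by (intro mult_right_mono) auto
    finally show "dist (gradient (f j) y) (gradient (f j) z) \<le> max L 0 * dist y z"
      by (simp add: dist_norm)
  qed simp
  then show ?thesis
    by (intro borel_measurable_continuous_onI lipschitz_on_continuous_on)
qed

lemma average_measurable [measurable]: "average n f \<in> borel_measurable borel"
proof -
  have "(\<lambda>y. 1 / real n * (\<Sum>j=1..n. f j y)) \<in> borel_measurable borel"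
    using component_measurable by (intro borel_measurable_times borel_measurable_sum) auto
  then show ?thesis
    by (simp add: average_def[abs_def])
qed

lemma gap_measurable [measurable]: "gap k \<in> borel_measurable P"
  unfolding gap_def[abs_def]
  by (intro borel_measurable_diff measurable_compose[OF iterate_measurable average_measurable]) simp

lemma gap_nonneg: "w \<in> argmin (average n f) \<Longrightarrow> gap k \<omega> \<ge> 0"
  using Inf_val_argmin[of w "average n f"] by (simp add: gap_def argmin_def)

text \<open>The index takes finitely many values, and on each set where it is constant the composite
  is measurable.\<close>

lemma index_compose_measurable:
  assumes "\<And>j. j \<in> {1..n} \<Longrightarrow> h j \<in> borel_measurable borel" "X \<in> borel_measurable P"
  shows "(\<lambda>\<omega>. h (i k \<omega>) (X \<omega>)) \<in> borel_measurable P"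
proof (rule measurable_compose_countable'[OF _ index_measurable])
  show "(\<lambda>\<omega>. h j (X \<omega>)) \<in> borel_measurable P" if "j \<in> {1..n}" for j
    using assms(2) assms(1)[OF that] by (rule measurable_compose)
qed simp

lemma sampled_gradient_measurable:
  assumes "X \<in> borel_measurable P"
  shows "(\<lambda>\<omega>. gradient (f (i k \<omega>)) (X \<omega>)) \<in> borel_measurable P"
  using gradient_measurable assms by (rule index_compose_measurable[where h = "\<lambda>j. gradient (f j)"])

lemma v_err_measurable [measurable]: "v_err f i e x k \<in> borel_measurable P"
  unfolding v_err_def[abs_def]
  using sampled_gradient_measurable[OF iterate_measurable] error_measurable
  by (rule borel_measurable_diff)

lemma one_step_descent:
  assumes "\<omega> \<in> space P"
  shows "(norm (x (Suc k) \<omega> - w))\<^sup>2 \<le> (norm (x k \<omega> - w))\<^sup>2 + \<alpha>\<^sup>2 * (norm (v_err f i e x k \<omega>))\<^sup>2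
      + 2 * \<alpha> * inner (e k \<omega>) (x k \<omega> - w) - 2 * \<alpha> * (f (i k \<omega>) (x k \<omega>) - f (i k \<omega>) w)"
proof -
  have "x (Suc k) \<omega> = prox (\<lambda>y. \<alpha> * f (i k \<omega>) y) (x k \<omega> + \<alpha> *\<^sub>R e k \<omega>)"
    using algorithm assms by (simp add: generic_algorithm_def)
  then show ?thesis
    using prox_step_descent[OF convex[OF index_in] differentiable[OF index_in] \<alpha>_pos, OF assms assms]
    by (simp only: v_err_def)
qed

section \<open>One step in expectation, for a fixed minimizer and finite second moments at time
  \<open>k\<close>\<close>

context
  fixes w :: 'h and k :: nat
  assumes w: "w \<in> argmin (average n f)"
    and sq_int: "integrable P (\<lambda>\<omega>. (norm (x k \<omega> - w))\<^sup>2)"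
    and \<sigma>_int: "integrable P (\<lambda>\<omega>. (\<sigma> k \<omega>)\<^sup>2)"
begin

text \<open>The gap grows at most quadratically in the distance \<open>d\<close> to
  \<open>w\<close>; its linear part is absorbed by \<open>d \<le> 1 + d\<^sup>2\<close>.\<close>

lemma component_gap_integrable:
  assumes j: "j \<in> {1..n}"
  shows "integrable P (\<lambda>\<omega>. f j (x k \<omega>) - f j w)"
proof (rule Bochner_Integration.integrable_bound)
  let ?K = "norm (gradient (f j) w)"
  show "integrable P (\<lambda>\<omega>. ?K + (?K + L) * (norm (x k \<omega> - w))\<^sup>2)"
    using sq_int by auto
  show "AE \<omega> in P. norm (f j (x k \<omega>) - f j w) \<le> norm (?K + (?K + L) * (norm (x k \<omega> - w))\<^sup>2)"
  proof (intro AE_I2)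
    fix \<omega>
    let ?d = "norm (x k \<omega> - w)"
    have "2 * ?d \<le> ?d\<^sup>2 + 1"
      using sum_squares_bound[of ?d 1] by simp
    then have "?d \<le> 1 + ?d\<^sup>2"
      using norm_ge_zero[of "x k \<omega> - w"] by linarith
    then have "?K * ?d \<le> ?K * (1 + ?d\<^sup>2)"
      by (intro mult_left_mono) auto
    then have "\<bar>f j (x k \<omega>) - f j w\<bar> \<le> ?K + (?K + L) * ?d\<^sup>2"
      using smooth_convex_gap_bound[OF convex smooth, OF j j, of "x k \<omega>" w]
      by (simp add: algebra_simps power2_eq_square)
    then show "norm (f j (x k \<omega>) - f j w) \<le> norm (?K + (?K + L) * ?d\<^sup>2)"
      by simp
  qed
  show "(\<lambda>\<omega>. f j (x k \<omega>) - f j w) \<in> borel_measurable P"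
    using component_measurable[OF j] by measurable
qed

text \<open>The infimum is the value at \<open>w\<close>. Single summands may have either sign; only
  their mean is known to be nonnegative.\<close>

lemma gap_eq: "gap k \<omega> = 1 / real n * (\<Sum>j=1..n. f j (x k \<omega>) - f j w)"
  by (simp add: gap_def Inf_val_argmin[OF w] average_def sum_subtractf diff_divide_distrib)

lemma gap_integrable: "integrable P (gap k)"
  unfolding gap_eq[abs_def]
  using component_gap_integrable
  by (intro Bochner_Integration.integrable_mult_right Bochner_Integration.integrable_sum) auto

text \<open>The iterate \<open>x k\<close> is measurable with respect to \<open>\<FF> k\<close>, of
  which the uniform index \<open>i k\<close> is independent, so averaging over the index turns the
  sampled component into the mean of all components.\<close>

lemma sampled_gap:
  shows "integrable P (\<lambda>\<omega>. f (i k \<omega>) (x k \<omega>) - f (i k \<omega>) w)"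
    and "(LINT \<omega>|P. f (i k \<omega>) (x k \<omega>) - f (i k \<omega>) w) = (LINT \<omega>|P. gap k \<omega>)"
proof -
  have "distr P (count_space {1..n}) (i k) = uniform_count_measure {1..n}"
    using algorithm by (simp add: generic_algorithm_def)
  moreover have "indep_set (sets (vimage_algebra (space P) (i k) (count_space {1..n}))) (sets (\<FF> k))"
    using variance by (simp add: variance_assumptions_def)
  moreover have "(\<lambda>\<omega>. f j (x k \<omega>) - f j w) \<in> borel_measurable (\<FF> k)" if "j \<in> {1..n}" for j
    using component_measurable[OF that] iterate_measurable_filtration[of k] by measurable
  ultimately show "integrable P (\<lambda>\<omega>. f (i k \<omega>) (x k \<omega>) - f (i k \<omega>) w)"
    "(LINT \<omega>|P. f (i k \<omega>) (x k \<omega>) - f (i k \<omega>) w) = (LINT \<omega>|P. gap k \<omega>)"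
    unfolding gap_eq
    using indep_uniform_index_integral[where h = "\<lambda>j \<omega>. f j (x k \<omega>) - f j w",
        OF n_pos index_measurable _ _ subalg _ component_gap_integrable]
    by auto
qed

text \<open>Integrating (B.ii) removes the conditioning, and the non-positive \<open>D\<close> is
  discarded. The bound is first obtained in [0, \<infinity>], where its finiteness yields
  integrability.\<close>

lemma v_err_second_moment:
  shows "integrable P (\<lambda>\<omega>. (norm (v_err f i e x k \<omega>))\<^sup>2)"
    and "(LINT \<omega>|P. (norm (v_err f i e x k \<omega>))\<^sup>2)
      \<le> 2 * A * (LINT \<omega>|P. gap k \<omega>) + B * (LINT \<omega>|P. (\<sigma> k \<omega>)\<^sup>2)"
proof -
  interpret finite_measure_subalgebra P "\<FF> k"
    by unfold_locales (rule subalg)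
  let ?v = "\<lambda>\<omega>. ennreal ((norm (v_err f i e x k \<omega>))\<^sup>2)"
  let ?r = "\<lambda>\<omega>. 2 * A * gap k \<omega> + B * (\<sigma> k \<omega>)\<^sup>2"
  have AB: "0 \<le> A" "0 \<le> B" and D: "\<And>\<omega>. \<omega> \<in> space P \<Longrightarrow> D \<omega> \<le> 0"
    using variance by (auto simp: variance_assumptions_def)
  have r_nonneg: "0 \<le> ?r \<omega>" for \<omega>
    using AB gap_nonneg[OF w] by simp
  have r_int: "integrable P ?r"
    using gap_integrable \<sigma>_int by auto
  have "AE \<omega> in P. enn2ereal (nn_cond_exp P (\<FF> k) ?v \<omega>) \<le> ereal (?r \<omega> + D \<omega>)"
    using variance by (simp add: variance_assumptions_def gap_def)
  then have "AE \<omega> in P. nn_cond_exp P (\<FF> k) ?v \<omega> \<le> ennreal (?r \<omega>)"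
  proof (rule AE_mp, intro AE_I2 impI)
    fix \<omega> assume "\<omega> \<in> space P" and le: "enn2ereal (nn_cond_exp P (\<FF> k) ?v \<omega>) \<le> ereal (?r \<omega> + D \<omega>)"
    \<comment> \<open>Passing from \<open>ereal\<close> to \<open>ennreal\<close> truncates at 0,
      which is monotone; once \<open>D\<close> is dropped the right-hand side is nonnegative and
      truncation leaves it unchanged.\<close>
    have "nn_cond_exp P (\<FF> k) ?v \<omega> \<le> ennreal (?r \<omega> + D \<omega>)"
      using e2ennreal_mono[OF le] by simp
    also have "\<dots> \<le> ennreal (?r \<omega>)"
      using D[OF \<open>\<omega> \<in> space P\<close>] by (intro ennreal_leI) simp
    finally show "nn_cond_exp P (\<FF> k) ?v \<omega> \<le> ennreal (?r \<omega>)" .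
  qed
  then have "(\<integral>\<^sup>+\<omega>. nn_cond_exp P (\<FF> k) ?v \<omega> \<partial>P) \<le> (\<integral>\<^sup>+\<omega>. ennreal (?r \<omega>) \<partial>P)"
    by (rule nn_integral_mono_AE)
  moreover have "(\<integral>\<^sup>+\<omega>. nn_cond_exp P (\<FF> k) ?v \<omega> \<partial>P) = (\<integral>\<^sup>+\<omega>. ?v \<omega> \<partial>P)"
    using nn_cond_exp_intg[of "\<lambda>_. 1" ?v] by simp
  moreover have "(\<integral>\<^sup>+\<omega>. ennreal (?r \<omega>) \<partial>P) = ennreal (LINT \<omega>|P. ?r \<omega>)"
    using r_int r_nonneg by (intro nn_integral_eq_integral) auto
  ultimately have le: "(\<integral>\<^sup>+\<omega>. ?v \<omega> \<partial>P) \<le> ennreal (LINT \<omega>|P. ?r \<omega>)"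
    by simp
  show int: "integrable P (\<lambda>\<omega>. (norm (v_err f i e x k \<omega>))\<^sup>2)"
    using le by (intro integrableI_nonneg) (auto intro: le_less_trans)
  have "(\<integral>\<^sup>+\<omega>. ?v \<omega> \<partial>P) = ennreal (LINT \<omega>|P. (norm (v_err f i e x k \<omega>))\<^sup>2)"
    using int by (intro nn_integral_eq_integral) auto
  with le have "(LINT \<omega>|P. (norm (v_err f i e x k \<omega>))\<^sup>2) \<le> (LINT \<omega>|P. ?r \<omega>)"
    using r_nonneg by (simp add: ennreal_le_iff integral_nonneg_AE)
  also have "\<dots> = 2 * A * (LINT \<omega>|P. gap k \<omega>) + B * (LINT \<omega>|P. (\<sigma> k \<omega>)\<^sup>2)"
    using gap_integrable \<sigma>_int by simp
  finally show "(LINT \<omega>|P. (norm (v_err f i e x k \<omega>))\<^sup>2)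
      \<le> 2 * A * (LINT \<omega>|P. gap k \<omega>) + B * (LINT \<omega>|P. (\<sigma> k \<omega>)\<^sup>2)" .
qed

text \<open>(B.i) gives only a first moment. The second one comes from writing \<open>e k\<close> as
  the sampled gradient at \<open>x k\<close> minus \<open>v_err\<close>: the gradient at
  \<open>w\<close> ranges over finitely many vectors, its change from \<open>w\<close> to
  \<open>x k\<close> is controlled by \<open>L\<close>, and \<open>v_err\<close> is square
  integrable.\<close>

lemma error_square_integrable: "integrable P (\<lambda>\<omega>. (norm (e k \<omega>))\<^sup>2)"
proof -
  let ?g = "\<lambda>\<omega> y. gradient (f (i k \<omega>)) y"
  let ?s = "\<Sum>j=1..n. norm (gradient (f j) w)"
  have meas: "(\<lambda>\<omega>. ?g \<omega> w) \<in> borel_measurable P" "(\<lambda>\<omega>. ?g \<omega> (x k \<omega>)) \<in> borel_measurable P"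
    using sampled_gradient_measurable[of "\<lambda>_. w"] sampled_gradient_measurable[OF iterate_measurable]
    by auto
  have "integrable P (\<lambda>\<omega>. (norm (?g \<omega> w))\<^sup>2)"
  proof (rule Bochner_Integration.integrable_bound)
    show "integrable P (\<lambda>\<omega>. ?s\<^sup>2)"
      by simp
    show "AE \<omega> in P. norm ((norm (?g \<omega> w))\<^sup>2) \<le> norm (?s\<^sup>2)"
    proof (intro AE_I2)
      fix \<omega> assume "\<omega> \<in> space P"
      then have "norm (?g \<omega> w) \<le> ?s"
        using index_in by (intro member_le_sum) auto
      then show "norm ((norm (?g \<omega> w))\<^sup>2) \<le> norm (?s\<^sup>2)"
        by (simp add: power_mono)
    qed
  qed (use meas in measurable)
  moreover have "integrable P (\<lambda>\<omega>. (norm (?g \<omega> (x k \<omega>) - ?g \<omega> w))\<^sup>2)"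
  proof (rule Bochner_Integration.integrable_bound)
    show "integrable P (\<lambda>\<omega>. L\<^sup>2 * (norm (x k \<omega> - w))\<^sup>2)"
      using sq_int by simp
    show "AE \<omega> in P. norm ((norm (?g \<omega> (x k \<omega>) - ?g \<omega> w))\<^sup>2) \<le> norm (L\<^sup>2 * (norm (x k \<omega> - w))\<^sup>2)"
    proof (intro AE_I2)
      fix \<omega> assume "\<omega> \<in> space P"
      then have "norm (?g \<omega> (x k \<omega>) - ?g \<omega> w) \<le> L * norm (x k \<omega> - w)"
        using smooth index_in by (simp add: smooth_with_def)
      then have "(norm (?g \<omega> (x k \<omega>) - ?g \<omega> w))\<^sup>2 \<le> (L * norm (x k \<omega> - w))\<^sup>2"
        by (intro power_mono) auto
      then show "norm ((norm (?g \<omega> (x k \<omega>) - ?g \<omega> w))\<^sup>2) \<le> norm (L\<^sup>2 * (norm (x k \<omega> - w))\<^sup>2)"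
        by (simp add: power_mult_distrib)
    qed
  qed (use meas in measurable)
  ultimately have "integrable P (\<lambda>\<omega>. (norm (?g \<omega> w + (?g \<omega> (x k \<omega>) - ?g \<omega> w)))\<^sup>2)"
    using meas by (intro integrable_norm_square_add) auto
  then have "integrable P (\<lambda>\<omega>. (norm (?g \<omega> (x k \<omega>) + - v_err f i e x k \<omega>))\<^sup>2)"
    using meas v_err_second_moment(1) by (intro integrable_norm_square_add) auto
  then show ?thesis
    by (simp add: v_err_def)
qed

text \<open>\<open>x k - w\<close> is measurable with respect to \<open>\<FF> k\<close>, and the
  product of the two norms is integrable because both factors are square integrable.\<close>

lemma error_orthogonal:
  shows "integrable P (\<lambda>\<omega>. inner (e k \<omega>) (x k \<omega> - w))"
    and "(LINT \<omega>|P. inner (e k \<omega>) (x k \<omega> - w)) = 0"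
proof -
  have int: "integrable P (\<lambda>\<omega>. norm (e k \<omega>) * norm (x k \<omega> - w))"
    using error_square_integrable sq_int by (intro integrable_norm_mult) auto
  then show "integrable P (\<lambda>\<omega>. inner (e k \<omega>) (x k \<omega> - w))"
    by (rule Bochner_Integration.integrable_bound) (auto simp: Cauchy_Schwarz_ineq2)
  have "has_cond_exp P (\<FF> k) (e k) (\<lambda>_. 0)"
    using variance by (simp add: variance_assumptions_def)
  then show "(LINT \<omega>|P. inner (e k \<omega>) (x k \<omega> - w)) = 0"
    using iterate_measurable_filtration int
    by (intro has_cond_exp_zero_orthogonal[OF subalg]) auto
qed

text \<open>Integrate the pathwise descent inequality. Its right-hand side is integrable and
  dominates the next squared distance, which carries the finite second moment over to time
  \<open>Suc k\<close>.\<close>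

lemma expected_descent:
  shows "integrable P (\<lambda>\<omega>. (norm (x (Suc k) \<omega> - w))\<^sup>2)"
    and "(LINT \<omega>|P. (norm (x (Suc k) \<omega> - w))\<^sup>2)
      \<le> (LINT \<omega>|P. (norm (x k \<omega> - w))\<^sup>2)
        + \<alpha>\<^sup>2 * (2 * A * (LINT \<omega>|P. gap k \<omega>) + B * (LINT \<omega>|P. (\<sigma> k \<omega>)\<^sup>2))
        - 2 * \<alpha> * (LINT \<omega>|P. gap k \<omega>)"
proof -
  define h where "h \<omega> = f (i k \<omega>) (x k \<omega>) - f (i k \<omega>) w" for \<omega>
  let ?R = "\<lambda>\<omega>. (norm (x k \<omega> - w))\<^sup>2 + \<alpha>\<^sup>2 * (norm (v_err f i e x k \<omega>))\<^sup>2
      + 2 * \<alpha> * inner (e k \<omega>) (x k \<omega> - w) - 2 * \<alpha> * h \<omega>"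
  note ints = sq_int v_err_second_moment(1) error_orthogonal(1) sampled_gap(1)[folded h_def]
  note descent = one_step_descent[where w = w and k = k, folded h_def]
  have R_int: "integrable P ?R"
    using ints by (intro Bochner_Integration.integrable_add Bochner_Integration.integrable_diff
        Bochner_Integration.integrable_mult_right) auto
  show int: "integrable P (\<lambda>\<omega>. (norm (x (Suc k) \<omega> - w))\<^sup>2)"
  proof (rule Bochner_Integration.integrable_bound[OF R_int])
    show "AE \<omega> in P. norm ((norm (x (Suc k) \<omega> - w))\<^sup>2) \<le> norm (?R \<omega>)"
      using descent by (intro AE_I2) (simp, smt (verit))
  qed measurable
  have "(LINT \<omega>|P. (norm (x (Suc k) \<omega> - w))\<^sup>2) \<le> (LINT \<omega>|P. ?R \<omega>)"
    using int R_int descent by (rule integral_mono)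
  also have "\<dots> = (LINT \<omega>|P. (norm (x k \<omega> - w))\<^sup>2) + \<alpha>\<^sup>2 * (LINT \<omega>|P. (norm (v_err f i e x k \<omega>))\<^sup>2)
      + 2 * \<alpha> * (LINT \<omega>|P. inner (e k \<omega>) (x k \<omega> - w))
      - 2 * \<alpha> * (LINT \<omega>|P. h \<omega>)"
    using ints by simp
  also have "\<dots> = (LINT \<omega>|P. (norm (x k \<omega> - w))\<^sup>2) + \<alpha>\<^sup>2 * (LINT \<omega>|P. (norm (v_err f i e x k \<omega>))\<^sup>2)
      - 2 * \<alpha> * (LINT \<omega>|P. gap k \<omega>)"
    by (simp add: error_orthogonal(2) sampled_gap(2)[folded h_def])
  also have "\<dots> \<le> (LINT \<omega>|P. (norm (x k \<omega> - w))\<^sup>2)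
        + \<alpha>\<^sup>2 * (2 * A * (LINT \<omega>|P. gap k \<omega>) + B * (LINT \<omega>|P. (\<sigma> k \<omega>)\<^sup>2))
        - 2 * \<alpha> * (LINT \<omega>|P. gap k \<omega>)"
    using v_err_second_moment(2) by (simp add: mult_left_mono)
  finally show "(LINT \<omega>|P. (norm (x (Suc k) \<omega> - w))\<^sup>2) \<le> \<dots>" .
qed

text \<open>(B.iii) is an inequality in [0, \<infinity>]. With finite moments at time
  \<open>k\<close> its right-hand side is finite, so it can be read among real integrals and also
  gives integrability at time \<open>Suc k\<close>.\<close>

lemma \<sigma>_recursion:
  shows "integrable P (\<lambda>\<omega>. (\<sigma> (Suc k) \<omega>)\<^sup>2)"
    and "(LINT \<omega>|P. (\<sigma> (Suc k) \<omega>)\<^sup>2)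
      \<le> (1 - \<rho>) * (LINT \<omega>|P. (\<sigma> k \<omega>)\<^sup>2) + 2 * C * (LINT \<omega>|P. gap k \<omega>)"
proof -
  have C: "0 \<le> C" and \<rho>: "\<rho> \<le> 1"
    using variance by (auto simp: variance_assumptions_def)
  let ?r = "(1 - \<rho>) * (LINT \<omega>|P. (\<sigma> k \<omega>)\<^sup>2) + 2 * C * (LINT \<omega>|P. gap k \<omega>)"
  have gap0: "0 \<le> (LINT \<omega>|P. gap k \<omega>)" and \<sigma>0: "0 \<le> (LINT \<omega>|P. (\<sigma> k \<omega>)\<^sup>2)"
    using gap_nonneg[OF w] by (auto intro: integral_nonneg_AE)
  then have r: "0 \<le> ?r"
    using C \<rho> by simp
  have "(\<integral>\<^sup>+\<omega>. ennreal ((\<sigma> (Suc k) \<omega>)\<^sup>2) \<partial>P)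
      \<le> ennreal (1 - \<rho>) * (\<integral>\<^sup>+\<omega>. ennreal ((\<sigma> k \<omega>)\<^sup>2) \<partial>P) + ennreal (2 * C) * (\<integral>\<^sup>+\<omega>. ennreal (gap k \<omega>) \<partial>P)"
    using variance by (simp add: variance_assumptions_def gap_def)
  also have "(\<integral>\<^sup>+\<omega>. ennreal ((\<sigma> k \<omega>)\<^sup>2) \<partial>P) = ennreal (LINT \<omega>|P. (\<sigma> k \<omega>)\<^sup>2)"
    using \<sigma>_int by (intro nn_integral_eq_integral) auto
  also have "(\<integral>\<^sup>+\<omega>. ennreal (gap k \<omega>) \<partial>P) = ennreal (LINT \<omega>|P. gap k \<omega>)"
    using gap_integrable gap_nonneg[OF w] by (intro nn_integral_eq_integral) auto
  also have "ennreal (1 - \<rho>) * ennreal (LINT \<omega>|P. (\<sigma> k \<omega>)\<^sup>2) + ennreal (2 * C) * ennreal (LINT \<omega>|P. gap k \<omega>) = ennreal ?r"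
    using C \<rho> gap0 \<sigma>0 by (simp add: ennreal_mult ennreal_plus)
  finally have le: "(\<integral>\<^sup>+\<omega>. ennreal ((\<sigma> (Suc k) \<omega>)\<^sup>2) \<partial>P) \<le> ennreal ?r" .
  then show int: "integrable P (\<lambda>\<omega>. (\<sigma> (Suc k) \<omega>)\<^sup>2)"
    by (intro integrableI_nonneg) (auto intro: le_less_trans)
  then have "(\<integral>\<^sup>+\<omega>. ennreal ((\<sigma> (Suc k) \<omega>)\<^sup>2) \<partial>P) = ennreal (LINT \<omega>|P. (\<sigma> (Suc k) \<omega>)\<^sup>2)"
    by (intro nn_integral_eq_integral) auto
  with le r show "(LINT \<omega>|P. (\<sigma> (Suc k) \<omega>)\<^sup>2) \<le> ?r"
    by (simp add: ennreal_le_iff)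
qed

end

section \<open>Telescoping and averaging\<close>

text \<open>Integrability is part of the induction claim, since the one-step estimates at time
  \<open>m\<close> presuppose it. The gap sum on the left collects the decrease of the Lyapunov
  function.\<close>

lemma Lyapunov_telescope:
  fixes w :: 'h
  assumes w: "w \<in> argmin (average n f)" and \<sigma>0: "integrable P (\<lambda>\<omega>. (\<sigma> 0 \<omega>)\<^sup>2)"
    and M: "0 \<le> M" "B \<le> \<rho> * M"
  shows "integrable P (\<lambda>\<omega>. (norm (x m \<omega> - w))\<^sup>2) \<and> integrable P (\<lambda>\<omega>. (\<sigma> m \<omega>)\<^sup>2) \<and>
    (LINT \<omega>|P. (norm (x m \<omega> - w))\<^sup>2) + \<alpha>\<^sup>2 * M * (LINT \<omega>|P. (\<sigma> m \<omega>)\<^sup>2)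
      + 2 * \<alpha> * (1 - \<alpha> * (A + M * C)) * (\<Sum>t<m. LINT \<omega>|P. gap t \<omega>)
    \<le> (norm (x0 - w))\<^sup>2 + \<alpha>\<^sup>2 * M * (LINT \<omega>|P. (\<sigma> 0 \<omega>)\<^sup>2)"
proof (induction m)
  case 0
  have x_0: "x 0 \<omega> = x0" if "\<omega> \<in> space P" for \<omega>
    using algorithm that by (simp add: generic_algorithm_def)
  have "integrable P (\<lambda>\<omega>. (norm (x 0 \<omega> - w))\<^sup>2) \<longleftrightarrow> integrable P (\<lambda>\<omega>. (norm (x0 - w))\<^sup>2)"
    using x_0 by (intro Bochner_Integration.integrable_cong) auto
  moreover have "(LINT \<omega>|P. (norm (x 0 \<omega> - w))\<^sup>2) = (LINT \<omega>|P. (norm (x0 - w))\<^sup>2)"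
    using x_0 by (intro Bochner_Integration.integral_cong) auto
  ultimately show ?case
    using \<sigma>0 by (simp add: prob_space)
next
  case (Suc m)
  then have int: "integrable P (\<lambda>\<omega>. (norm (x m \<omega> - w))\<^sup>2)" "integrable P (\<lambda>\<omega>. (\<sigma> m \<omega>)\<^sup>2)"
    by auto
  let ?g = "LINT \<omega>|P. gap m \<omega>" and ?s = "\<lambda>m. LINT \<omega>|P. (\<sigma> m \<omega>)\<^sup>2"
    and ?d = "\<lambda>m. LINT \<omega>|P. (norm (x m \<omega> - w))\<^sup>2"
  have "?d (Suc m) \<le> ?d m + \<alpha>\<^sup>2 * (2 * A * ?g + B * ?s m) - 2 * \<alpha> * ?g"
    by (rule expected_descent(2)[OF w int])
  moreover have "\<alpha>\<^sup>2 * M * ?s (Suc m) \<le> \<alpha>\<^sup>2 * M * ((1 - \<rho>) * ?s m + 2 * C * ?g)"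
    using M by (intro mult_left_mono \<sigma>_recursion(2)[OF w int]) simp
  \<comment> \<open>The condition on \<open>M\<close> lets the contraction by \<rho> in the
    recursion for \<sigma> pay for the term with \<open>B\<close> in the descent. What remains is
    the gap, with coefficient
    \<open>2 * \<alpha> - 2 * \<alpha>\<^sup>2 * (A + M * C)\<close>.\<close>
  moreover have "\<alpha>\<^sup>2 * (B * ?s m) \<le> \<alpha>\<^sup>2 * (\<rho> * M * ?s m)"
    using M by (intro mult_left_mono mult_right_mono) (auto intro: integral_nonneg_AE)
  ultimately have "?d (Suc m) + \<alpha>\<^sup>2 * M * ?s (Suc m) + 2 * \<alpha> * (1 - \<alpha> * (A + M * C)) * ?g
      \<le> ?d m + \<alpha>\<^sup>2 * M * ?s m"
    by (simp add: algebra_simps power2_eq_square)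
  with Suc have "?d (Suc m) + \<alpha>\<^sup>2 * M * ?s (Suc m)
      + 2 * \<alpha> * (1 - \<alpha> * (A + M * C)) * (\<Sum>t<Suc m. LINT \<omega>|P. gap t \<omega>)
      \<le> (norm (x0 - w))\<^sup>2 + \<alpha>\<^sup>2 * M * ?s 0"
    by (simp add: distrib_left)
  then show ?case
    using expected_descent(1)[OF w int] \<sigma>_recursion(1)[OF w int] by blast
qed

lemma average_convex: "convex_on UNIV (average n f)"
proof -
  have "convex_on UNIV (\<lambda>y. \<Sum>j\<in>J. f j y)" if "finite J" "J \<subseteq> {1..n}" for J
    using that convex by (induction J) (auto intro: convex_on_add simp: convex_on_const)
  then show ?thesis
    unfolding average_def[abs_def] by (intro convex_on_cmul) auto
qed

text \<open>Jensen's inequality with equal weights; for \<open>k \<ge> 1\<close> they sum to 1, so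
  the infimum is subtracted exactly once.\<close>

lemma averaged_gap_le:
  assumes "k \<ge> 1"
  shows "average n f ((1 / real k) *\<^sub>R (\<Sum>t<k. x t \<omega>)) - Inf_val (average n f)
    \<le> 1 / real k * (\<Sum>t<k. gap t \<omega>)"
proof -
  have "average n f (\<Sum>t<k. (1 / real k) *\<^sub>R x t \<omega>) \<le> (\<Sum>t<k. 1 / real k * average n f (x t \<omega>))"
    using assms by (intro convex_on_sum[OF _ _ average_convex]) (auto simp: lessThan_empty_iff)
  then show ?thesis
    using assms by (simp add: gap_def sum_subtractf scaleR_sum_right[symmetric]
        sum_divide_distrib[symmetric] diff_divide_distrib)
qed

text \<open>The distance and \<sigma> terms of the Lyapunov function at time \<open>k\<close> are
  nonnegative and may be dropped; dividing by \<open>real k * c\<close> bounds the mean gap, to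
  which Jensen's inequality applies.\<close>

lemma expected_averaged_gap_le:
  fixes w :: 'h
  assumes w: "w \<in> argmin (average n f)" and \<sigma>0: "integrable P (\<lambda>\<omega>. (\<sigma> 0 \<omega>)\<^sup>2)"
    and M: "0 \<le> M" "B \<le> \<rho> * M" and step: "\<alpha> * (A + M * C) < 1" and k: "k \<ge> 1"
  shows "(\<integral>\<^sup>+\<omega>. ennreal (average n f ((1 / real k) *\<^sub>R (\<Sum>t<k. x t \<omega>)) - Inf_val (average n f)) \<partial>P)
    \<le> ennreal (((dist x0 w)\<^sup>2 + \<alpha>\<^sup>2 * M * (LINT \<omega>|P. (\<sigma> 0 \<omega>)\<^sup>2))
        / (2 * \<alpha> * real k * (1 - \<alpha> * (A + M * C))))"
proof -
  note tele = Lyapunov_telescope[OF w \<sigma>0 M]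
  \<comment> \<open>The guaranteed decrease per unit of gap; it is positive by the step-size
    condition.\<close>
  define c where "c = 2 * \<alpha> * (1 - \<alpha> * (A + M * C))"
  have c: "c > 0"
    using \<alpha>_pos step by (simp add: c_def)
  have gap_int: "integrable P (gap t)" for t
    using tele by (intro gap_integrable[OF w]) auto
  have "0 \<le> (LINT \<omega>|P. (norm (x k \<omega> - w))\<^sup>2)" "0 \<le> \<alpha>\<^sup>2 * M * (LINT \<omega>|P. (\<sigma> k \<omega>)\<^sup>2)"
    using M by (auto intro!: integral_nonneg_AE mult_nonneg_nonneg)
  then have "c * (\<Sum>t<k. LINT \<omega>|P. gap t \<omega>) \<le> (dist x0 w)\<^sup>2 + \<alpha>\<^sup>2 * M * (LINT \<omega>|P. (\<sigma> 0 \<omega>)\<^sup>2)"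
    using tele[of k] unfolding c_def dist_norm by linarith
  then have bound: "1 / real k * (\<Sum>t<k. LINT \<omega>|P. gap t \<omega>)
      \<le> ((dist x0 w)\<^sup>2 + \<alpha>\<^sup>2 * M * (LINT \<omega>|P. (\<sigma> 0 \<omega>)\<^sup>2)) / (real k * c)"
    using c k by (simp add: field_simps)
  have "(\<integral>\<^sup>+\<omega>. ennreal (average n f ((1 / real k) *\<^sub>R (\<Sum>t<k. x t \<omega>)) - Inf_val (average n f)) \<partial>P)
      \<le> (\<integral>\<^sup>+\<omega>. ennreal (1 / real k * (\<Sum>t<k. gap t \<omega>)) \<partial>P)"
    by (intro nn_integral_mono ennreal_leI averaged_gap_le k)
  also have "\<dots> = ennreal (LINT \<omega>|P. 1 / real k * (\<Sum>t<k. gap t \<omega>))"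
    using gap_int gap_nonneg[OF w]
    by (intro nn_integral_eq_integral Bochner_Integration.integrable_mult_right
        Bochner_Integration.integrable_sum) (auto intro!: AE_I2 divide_nonneg_nonneg sum_nonneg)
  also have "(LINT \<omega>|P. 1 / real k * (\<Sum>t<k. gap t \<omega>)) = 1 / real k * (\<Sum>t<k. LINT \<omega>|P. gap t \<omega>)"
    using gap_int by (simp add: Bochner_Integration.integral_sum)
  also have "ennreal \<dots> \<le> ennreal (((dist x0 w)\<^sup>2 + \<alpha>\<^sup>2 * M * (LINT \<omega>|P. (\<sigma> 0 \<omega>)\<^sup>2)) / (real k * c))"
    using bound by (rule ennreal_leI)
  finally show ?thesis
    by (simp add: c_def mult_ac)
qed

end

section \<open>Passage from single minimizers to the distance\<close>

theorem theorem3p2: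
  fixes P :: "'w measure"
    and f :: "nat \<Rightarrow> 'h::{real_inner, banach, second_countable_topology} \<Rightarrow> real"
    and x e :: "nat \<Rightarrow> 'w \<Rightarrow> 'h" and x0 :: 'h
    and i :: "nat \<Rightarrow> 'w \<Rightarrow> nat" and \<sigma> :: "nat \<Rightarrow> 'w \<Rightarrow> real" and D :: "'w \<Rightarrow> real"
    and \<FF> :: "nat \<Rightarrow> 'w measure"
    and L \<alpha> A B C \<rho> M :: real and n k :: nat
  assumes "prob_space P"
    and "n \<ge> 1"
    and "argmin (average n f) \<noteq> {}"
    and "L > 0"
    and "\<And>j. j \<in> {1..n} \<Longrightarrow> convex_on UNIV (f j)"
    and "\<And>j. j \<in> {1..n} \<Longrightarrow> smooth_with L (f j)"
    and "\<alpha> > 0"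
    and "generic_algorithm P n f \<alpha> x0 i e x"
    and "variance_assumptions P n f i e x A B C \<rho> D \<sigma> \<FF>"
    and "\<rho> > 0"
    and "M > 0"
    and "M \<ge> B / \<rho>"
    and "ereal \<alpha> < 1 / ereal (A + M * C)"
    and "k \<ge> 1"
  shows "(\<integral>\<^sup>+\<omega>. ennreal (average n f ((1 / real k) *\<^sub>R (\<Sum>t<k. x t \<omega>)) - Inf_val (average n f)) \<partial>P)
    \<le> (ennreal ((infdist x0 (argmin (average n f)))\<^sup>2)
         + ennreal (\<alpha>\<^sup>2 * M) * (\<integral>\<^sup>+\<omega>. ennreal ((\<sigma> 0 \<omega>)\<^sup>2) \<partial>P))
      / ennreal (2 * \<alpha> * real k * (1 - \<alpha> * (A + M * C)))"
    (is "?lhs \<le> _ / ennreal ?q")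
proof -
  interpret prob_space P
    by fact
  interpret variance_reduced_prox P f x e x0 i \<sigma> D \<FF> L \<alpha> A B C \<rho> n
    by unfold_locales (use assms in auto)
  have AC: "0 \<le> A" "0 \<le> C"
    using variance by (auto simp: variance_assumptions_def)
  have step: "\<alpha> * (A + M * C) < 1"
  \<comment> \<open>In the extended reals the quotient by 0 is \<infinity>; there the claim reads 0
    < 1. Otherwise the hypothesis can be multiplied by the positive denominator.\<close>
  proof (cases "A + M * C = 0")
    case False
    then have "0 < A + M * C"
      using AC \<open>M > 0\<close> by (simp add: order_less_le)
    with assms(13) show ?thesis
      by (simp add: one_ereal_def field_simps)
  qed simp
  have q: "0 < ?q"
    using step \<open>\<alpha> > 0\<close> \<open>k \<ge> 1\<close> by simp
  have B: "B \<le> \<rho> * M"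
    using \<open>M \<ge> B / \<rho>\<close> \<open>\<rho> > 0\<close> by (simp add: field_simps)
  show ?thesis
  \<comment> \<open>If the initial moment is infinite, its positive coefficient makes the numerator
    infinite, and division by a finite number leaves the right-hand side infinite.\<close>
  proof (cases "(\<integral>\<^sup>+\<omega>. ennreal ((\<sigma> 0 \<omega>)\<^sup>2) \<partial>P) = \<infinity>")
    case True
    then show ?thesis
      using \<open>M > 0\<close> \<open>\<alpha> > 0\<close> by (simp add: ennreal_mult_top ennreal_top_divide)
  next
    case False
    then have \<sigma>0: "integrable P (\<lambda>\<omega>. (\<sigma> 0 \<omega>)\<^sup>2)"
      by (intro integrableI_nonneg) (auto simp: less_top)
    let ?s = "\<alpha>\<^sup>2 * M * (LINT \<omega>|P. (\<sigma> 0 \<omega>)\<^sup>2)"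
    have s: "0 \<le> ?s"
      using \<open>M > 0\<close> by (auto intro!: mult_nonneg_nonneg integral_nonneg_AE)
    obtain w where w: "\<And>j::nat. w j \<in> argmin (average n f)"
      "(\<lambda>j. dist x0 (w j)) \<longlonglongrightarrow> infdist x0 (argmin (average n f))"
      using infdist_approx[OF assms(3)] by blast
    \<comment> \<open>The left-hand side does not depend on the minimizer, so the bound survives the
      limit along minimizers whose distances to \<open>x0\<close> tend to the infimum.\<close>
    have "?lhs \<le> ennreal (((infdist x0 (argmin (average n f)))\<^sup>2 + ?s) / ?q)"
    proof (rule LIMSEQ_le_const)
      show "(\<lambda>j. ennreal (((dist x0 (w j))\<^sup>2 + ?s) / ?q))
          \<longlonglongrightarrow> ennreal (((infdist x0 (argmin (average n f)))\<^sup>2 + ?s) / ?q)"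
        using q by (intro tendsto_ennrealI tendsto_intros w(2)) linarith
      show "\<exists>N. \<forall>j\<ge>N. ?lhs \<le> ennreal (((dist x0 (w j))\<^sup>2 + ?s) / ?q)"
        using expected_averaged_gap_le[OF w(1) \<sigma>0 _ B step \<open>k \<ge> 1\<close>] \<open>M > 0\<close> by auto
    qed
    also have "\<dots> = (ennreal ((infdist x0 (argmin (average n f)))\<^sup>2) + ennreal ?s) / ennreal ?q"
      using q s by (simp add: divide_ennreal ennreal_plus[symmetric] del: ennreal_plus)
    also have "ennreal ?s = ennreal (\<alpha>\<^sup>2 * M) * (\<integral>\<^sup>+\<omega>. ennreal ((\<sigma> 0 \<omega>)\<^sup>2) \<partial>P)"
      using \<sigma>0 \<open>M > 0\<close> by (simp add: ennreal_mult nn_integral_eq_integral integral_nonneg_AE)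
    finally show ?thesis .
  qed
qed

end
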